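(* For a connected graph $G$ of order $n\ge2$ and for a real number $k\in[1,\kappa(G)]$: (a) $\dim_f^k(G)=k$ if and only if $G\cong P_n$ and $k\in[1,2]$; (b) $\dim_f^k(G)=n$ if and only if $k=\kappa(G)=\kappa$ and $V(G)=\mathcal{R}_\kappa(G)$.
   Context: All graphs are finite, simple and undirected; the order of $G$ is $|V(G)|$; $P_n$ is the path on $n$ vertices. $d(x,y)$ is the length of a shortest path between $x$ and $y$ in $G$. For distinct $x,y\in V(G)$, let $R\{x,y\}=\{z\in V(G): d(x,z)\neq d(y,z)\}$, and let $\kappa=\kappa(G)=\min\{|R\{x,y\}|: x\neq y,\ x,y\in V(G)\}$. Let $\mathcal{R}_\kappa(G)$ be the union of the sets $R\{x,y\}$ over all pairs of distinct vertices $x,y\in V(G)$ with $|R\{x,y\}|=\kappa$. For a function $g$ on $V(G)$ and $U\subseteq V(G)$, write $g(U)=\sum_{s\in U}g(s)$. For a real number $k\in[1,\kappa(G)]$, a function $g:V(G)\to[0,1]$ is a $k$-resolving function of $G$ if $g(R\{x,y\})\ge k$ for any two distinct vertices $x,y\in V(G)$; the fractional $k$-metric dimension is $\dim_f^k(G)=\min\{g(V(G)): g \text{ is a } k\text{-resolving function of } G\}$. *)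

theory Defs
  imports "Graph_Theory.Graph_Theory"
begin

text \<open>A finite simple undirected graph is an element of the AFP locale \<^locale>\<open>Digraph.graph\<close>:
  a finite, loop-free, symmetric digraph without parallel arcs, each edge being
  represented by its two orientations.\<close>

text \<open>Unit arc weights turn the AFP shortest-path cost into the length of a shortest path.\<close>

definition gdist :: "('a, 'b) pre_digraph \<Rightarrow> 'a \<Rightarrow> 'a \<Rightarrow> ereal" where
  "gdist G x y = wf_digraph.\<mu> G (\<lambda>_. 1) x y"

definition resolving_set :: "('a, 'b) pre_digraph \<Rightarrow> 'a \<Rightarrow> 'a \<Rightarrow> 'a set" where
  "resolving_set G x y = {z \<in> verts G. gdist G x z \<noteq> gdist G y z}"

definition kappa :: "('a, 'b) pre_digraph \<Rightarrow> nat" where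
  "kappa G = Min {card (resolving_set G x y) | x y. x \<in> verts G \<and> y \<in> verts G \<and> x \<noteq> y}"

definition R_kappa :: "('a, 'b) pre_digraph \<Rightarrow> 'a set" where
  "R_kappa G = \<Union> {resolving_set G x y | x y.
     x \<in> verts G \<and> y \<in> verts G \<and> x \<noteq> y \<and> card (resolving_set G x y) = kappa G}"

text \<open>Only the values of \<open>g\<close> on the vertex set matter; elsewhere \<open>g\<close> is unconstrained.\<close>

definition k_resolving_function :: "('a, 'b) pre_digraph \<Rightarrow> real \<Rightarrow> ('a \<Rightarrow> real) \<Rightarrow> bool" where
  "k_resolving_function G k g \<longleftrightarrow>
     g \<in> verts G \<rightarrow> {0..1} \<and>
     (\<forall>x \<in> verts G. \<forall>y \<in> verts G. x \<noteq> y \<longrightarrow> sum g (resolving_set G x y) \<ge> k)"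

text \<open>On the reals, \<^const>\<open>Least\<close> denotes the minimum of a set and is unspecified if the minimum
  does not exist. For \<open>1 \<le> k \<le> kappa G\<close> it exists, by compactness.\<close>

definition frac_metric_dim :: "('a, 'b) pre_digraph \<Rightarrow> real \<Rightarrow> real" where
  "frac_metric_dim G k = (LEAST t. \<exists>g. k_resolving_function G k g \<and> t = sum g (verts G))"

definition path_graph :: "nat \<Rightarrow> nat pair_pre_digraph" where
  "path_graph n = \<lparr> pverts = {..<n},
     parcs = {(i, j). i < n \<and> j < n \<and> (j = Suc i \<or> i = Suc j)} \<rparr>"

end

theory Submission
  imports Defs "HOL-Analysis.Function_Topology"
begin

text \<open>The total weight of a k-resolving function is at least k. If it equals k, every vertex of
  positive weight resolves all pairs, so the distances from such a vertex are pairwise distinct;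
  numbering the vertices by these distances exhibits the graph as a path with that vertex as an
  end. A path has only two ends and weights are at most 1, hence \<open>k \<le> 2\<close>. Conversely, on a path,
  weight \<open>k / 2\<close> on both ends is optimal.

  For (b), a resolving set of size \<open>kappa\<close> forces weight 1 on all its vertices when \<open>k = kappa\<close>.
  If \<open>k < kappa\<close>, the constant \<open>k / kappa\<close> beats the constant 1, and if \<open>k = kappa\<close>, a vertex
  outside \<open>R_kappa\<close> can be given weight 0.\<close>

section \<open>Distances\<close>

context wf_digraph
begin

text \<open>With unit weights the cost of a walk is its length. A single walk thus bounds the
  distance from above, and a bound valid for all walks bounds it from below.\<close>

lemma gdist_eq_INF_length:
  "gdist G u v = (INF p \<in> {p. awalk u p v}. ereal (real (length p)))"
  by (simp add: gdist_def \<mu>_def awalk_cost_def sum_list_triv)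

lemma gdist_le_length: "awalk u p v \<Longrightarrow> gdist G u v \<le> ereal (real (length p))"
  unfolding gdist_eq_INF_length by (auto intro: INF_lower)

lemma gdist_self:
  assumes "u \<in> verts G" shows "gdist G u u = 0"
proof (rule antisym)
  show "gdist G u u \<le> 0"
    using gdist_le_length[of u "[]" u] assms by (simp add: awalk_Nil_iff zero_ereal_def)
  show "0 \<le> gdist G u u"
    unfolding gdist_eq_INF_length by (auto intro: INF_greatest)
qed

end

lemma (in fin_digraph) gdist_adj_le:
  assumes "u \<rightarrow>\<^bsub>G\<^esub> v" shows "gdist G s v \<le> gdist G s u + 1"
proof -
  obtain e where "e \<in> arcs G" "arc_to_ends G e = (u, v)"
    using assms by (auto simp: arcs_ends_def)
  then show ?thesis
    using pos_cost_mu_triangle[of "\<lambda>_. 1" e u v s] by (simp add: gdist_def one_ereal_def)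
qed

text \<open>The vertex \<open>u\<close> is the last but one on a shortest walk from \<open>s\<close>
  to \<open>v\<close>.\<close>

lemma (in fin_digraph) gdist_predecessor:
  assumes "s \<rightarrow>\<^sup>* v" "v \<noteq> s"
  obtains u where "u \<rightarrow>\<^bsub>G\<^esub> v" "gdist G s v = gdist G s u + 1"
proof -
  obtain u e where "\<mu> (\<lambda>_. 1) s v = \<mu> (\<lambda>_. 1) s u + ereal 1" "arc e (u, v)"
    using mu_exact_triangle[of v s "\<lambda>_. 1"] assms by auto
  then show ?thesis
    using that[of u] by (auto simp: gdist_def one_ereal_def arc_def arcs_ends_conv)
qed

text \<open>The infimum is attained by an actual walk, so distances between reachable vertices can
  serve as natural-number labels.\<close>

lemma (in fin_digraph) gdist_eq_nat:
  assumes "u \<rightarrow>\<^sup>* v"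
  obtains m :: nat where "gdist G u v = ereal (real m)"
proof -
  obtain p where "\<mu> (\<lambda>_. 1) u v = ereal (awalk_cost (\<lambda>_. 1) p)"
    using min_cost_awalk[OF assms, of "\<lambda>_. 1"] by auto
  then show ?thesis
    using that[of "length p"] by (simp add: gdist_def awalk_cost_def sum_list_triv)
qed

context sym_digraph
begin

lemma adj_sym: "u \<rightarrow>\<^bsub>G\<^esub> v \<Longrightarrow> v \<rightarrow>\<^bsub>G\<^esub> u"
  using sym_arcs by (rule arcs_ends_symmetric)

text \<open>Walks are lists of arcs, so reversing one means replacing each arc by an opposite arc,
  which symmetry supplies. Only the length matters for the distance.\<close>

lemma awalk_reverse:
  assumes "awalk u p v"
  obtains q where "awalk v q u" "length q = length p"
proof -
  have "\<exists>q. awalk v q u \<and> length q = length p"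
    using assms
  proof (induction p arbitrary: u)
    case Nil
    then show ?case by (auto simp: awalk_Nil_iff)
  next
    case (Cons e p)
    then have e: "e \<in> arcs G" "tail G e = u" "awalk (head G e) p v"
      by (auto simp: awalk_Cons_iff)
    then obtain q where q: "awalk v q (head G e)" "length q = length p"
      using Cons.IH by blast
    obtain e' where "e' \<in> arcs G" "tail G e' = head G e" "head G e' = u"
      using sym_arcs e by (metis symmetric_conv)
    then have "awalk (head G e) [e'] u"
      by (auto simp: awalk_simps)
    with q have "awalk v (q @ [e']) u" "length (q @ [e']) = length (e # p)"
      by auto
    then show ?case by blast
  qed
  then show ?thesis using that by blast
qed

lemma gdist_sym: "gdist G u v = gdist G v u"
proof -
  have "gdist G u v \<le> gdist G v u" for u v
    unfolding gdist_eq_INF_length[of v u]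
    by (intro INF_greatest) (metis awalk_reverse gdist_le_length mem_Collect_eq)
  then show ?thesis by (simp add: antisym)
qed

lemma connected_reachable:
  assumes "connected G" "u \<in> verts G" "v \<in> verts G"
  shows "u \<rightarrow>\<^sup>* v"
  using assms reachable_mk_symmetric_eq[OF sym_arcs]
  by (auto simp: connected_def)

end


section \<open>Path labellings\<close>

text \<open>An isomorphism onto the path expressed through vertices and adjacency only, so that no
  map on arcs has to be carried along.\<close>

definition path_labelling :: "('a, 'b) pre_digraph \<Rightarrow> ('a \<Rightarrow> nat) \<Rightarrow> bool" where
  "path_labelling G f \<longleftrightarrow> bij_betw f (verts G) {..<card (verts G)} \<and>
     (\<forall>x \<in> verts G. \<forall>y \<in> verts G. x \<rightarrow>\<^bsub>G\<^esub> y \<longleftrightarrow> f x = Suc (f y) \<or> f y = Suc (f x))"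

lemma path_labelling_inj_on: "path_labelling G f \<Longrightarrow> inj_on f (verts G)"
  by (simp add: path_labelling_def bij_betw_def)

lemma path_labelling_less: "path_labelling G f \<Longrightarrow> x \<in> verts G \<Longrightarrow> f x < card (verts G)"
  by (auto simp: path_labelling_def bij_betw_def)

lemma path_labelling_adj_iff:
  "path_labelling G f \<Longrightarrow> x \<in> verts G \<Longrightarrow> y \<in> verts G \<Longrightarrow>
     x \<rightarrow>\<^bsub>G\<^esub> y \<longleftrightarrow> f x = Suc (f y) \<or> f y = Suc (f x)"
  by (auto simp: path_labelling_def)

lemma path_labelling_vertex:
  assumes "path_labelling G f" "i < card (verts G)"
  obtains x where "x \<in> verts G" "f x = i"
proof -
  have "i \<in> f ` verts G"
    using assms by (simp add: path_labelling_def bij_betw_def)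
  then show ?thesis using that by blast
qed

text \<open>Lets the last vertex of the path be treated as one with label 0.\<close>

lemma path_labelling_reverse:
  assumes "path_labelling G f"
  shows "path_labelling G (\<lambda>x. card (verts G) - Suc (f x))"
  unfolding path_labelling_def
proof (intro conjI ballI)
  have "bij_betw (\<lambda>i. card (verts G) - Suc i) {..<card (verts G)} {..<card (verts G)}"
    by (rule bij_betw_byWitness[of _ "\<lambda>i. card (verts G) - Suc i"]) auto
  then have "bij_betw ((\<lambda>i. card (verts G) - Suc i) \<circ> f) (verts G) {..<card (verts G)}"
    using assms by (auto simp: path_labelling_def intro: bij_betw_trans)
  then show "bij_betw (\<lambda>x. card (verts G) - Suc (f x)) (verts G) {..<card (verts G)}"
    by (simp add: comp_def)
next
  fix x y assume xy: "x \<in> verts G" "y \<in> verts G"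
  show "x \<rightarrow>\<^bsub>G\<^esub> y \<longleftrightarrow>
      card (verts G) - Suc (f x) = Suc (card (verts G) - Suc (f y)) \<or>
      card (verts G) - Suc (f y) = Suc (card (verts G) - Suc (f x))"
    unfolding path_labelling_adj_iff[OF assms xy]
    using path_labelling_less[OF assms xy(1)] path_labelling_less[OF assms xy(2)] by arith
qed

text \<open>Without parallel arcs an arc is determined by its ends, so a vertex bijection respecting
  adjacency already induces the map on arcs.\<close>

lemma (in nomulti_digraph) digraph_iso_path_iff:
  "digraph_iso G (with_proj (path_graph (card (verts G)))) \<longleftrightarrow> (\<exists>f. path_labelling G f)"
proof
  assume "digraph_iso G (with_proj (path_graph (card (verts G))))"
  then obtain h where h: "digraph_isomorphism h"
    and eq: "with_proj (path_graph (card (verts G))) = app_iso h G"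
    by (auto simp: digraph_iso_def)
  let ?f = "iso_verts h"
  have inj: "inj_on ?f (verts G)"
    using h by (rule digraph_isomorphism_inj_on_verts)
  have img: "?f ` verts G = {..<card (verts G)}"
    using arg_cong[OF eq, of verts] by (simp add: path_graph_def)
  have ends: "parcs (path_graph (card (verts G))) = (\<lambda>(u, v). (?f u, ?f v)) ` arcs_ends G"
    using arg_cong[OF eq, of arcs_ends] arcs_ends_app_iso_eq[OF h] by simp
  have "x \<rightarrow>\<^bsub>G\<^esub> y \<longleftrightarrow> ?f x = Suc (?f y) \<or> ?f y = Suc (?f x)"
    if xy: "x \<in> verts G" "y \<in> verts G" for x y
  proof -
    have "x \<rightarrow>\<^bsub>G\<^esub> y \<longleftrightarrow> (?f x, ?f y) \<in> (\<lambda>(u, v). (?f u, ?f v)) ` arcs_ends G"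
    proof
      assume "(?f x, ?f y) \<in> (\<lambda>(u, v). (?f u, ?f v)) ` arcs_ends G"
      then obtain u v where uv: "u \<rightarrow>\<^bsub>G\<^esub> v" "?f x = ?f u" "?f y = ?f v" by auto
      then have "x = u" "y = v"
        using xy adj_in_verts[OF uv(1)] inj by (auto dest: inj_onD)
      with uv(1) show "x \<rightarrow>\<^bsub>G\<^esub> y" by simp
    qed force
    also have "\<dots> \<longleftrightarrow> ?f x = Suc (?f y) \<or> ?f y = Suc (?f x)"
      using xy img unfolding ends[symmetric] by (auto simp: path_graph_def)
    finally show ?thesis .
  qed
  then have "path_labelling G ?f"
    using inj img by (simp add: path_labelling_def bij_betw_def)
  then show "\<exists>f. path_labelling G f" by blast
next
  assume "\<exists>f. path_labelling G f"
  then obtain f where f: "path_labelling G f" ..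
  \<comment> \<open>Arcs of \<open>path_graph\<close> are pairs of numbers, so each arc goes to the
    pair of labels of its ends, with \<open>fst\<close> and \<open>snd\<close> as tail and
    head.\<close>
  define h where "h = \<lparr>iso_verts = f, iso_arcs = (\<lambda>a. (f (tail G a), f (head G a))),
    iso_head = snd, iso_tail = fst\<rparr>"
  have inj: "inj_on f (verts G)" and img: "f ` verts G = {..<card (verts G)}"
    using f by (auto simp: path_labelling_def bij_betw_def)
  have "inj_on (\<lambda>a. (f (tail G a), f (head G a))) (arcs G)"
  proof (rule inj_onI)
    fix a b assume "a \<in> arcs G" "b \<in> arcs G"
      "(f (tail G a), f (head G a)) = (f (tail G b), f (head G b))"
    then show "a = b"
      using inj by (intro no_multi_arcs) (auto simp: arc_to_ends_def dest: inj_onD)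
  qed
  then have "digraph_isomorphism h"
    using inj wf_digraph by (simp add: h_def digraph_isomorphism_def)
  moreover have "parcs (path_graph (card (verts G))) =
      (\<lambda>a. (f (tail G a), f (head G a))) ` arcs G" (is "?L = ?R")
  proof (intro equalityI subrelI)
    fix i j assume "(i, j) \<in> ?L"
    then have ij: "i < card (verts G)" "j < card (verts G)" "j = Suc i \<or> i = Suc j"
      by (auto simp: path_graph_def)
    obtain x y where xy: "x \<in> verts G" "f x = i" "y \<in> verts G" "f y = j"
      using ij path_labelling_vertex[OF f] by metis
    then have "x \<rightarrow>\<^bsub>G\<^esub> y"
      using ij path_labelling_adj_iff[OF f, of x y] by auto
    then show "(i, j) \<in> ?R"
      using xy by (force simp: arcs_ends_conv)
  next
    fix i j assume "(i, j) \<in> ?R"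
    then obtain a where a: "a \<in> arcs G" "i = f (tail G a)" "j = f (head G a)"
      by auto
    then have "tail G a \<rightarrow>\<^bsub>G\<^esub> head G a"
      by (auto simp: arcs_ends_conv)
    then show "(i, j) \<in> ?L"
      using a path_labelling_adj_iff[OF f, of "tail G a" "head G a"]
        path_labelling_less[OF f, of "tail G a"] path_labelling_less[OF f, of "head G a"]
      by (auto simp: path_graph_def)
  qed
  then have "with_proj (path_graph (card (verts G))) = app_iso h G"
    using img by (simp add: h_def app_iso_def with_proj_def) (simp add: path_graph_def)
  ultimately show "digraph_iso G (with_proj (path_graph (card (verts G))))"
    by (auto simp: digraph_iso_def)
qed

text \<open>Stepping through consecutive labels gives a walk of length \<open>f y\<close>. No walk
  is shorter, because a label rises by at most one along an arc.\<close>

lemma (in fin_digraph) gdist_path_labelling: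
  assumes f: "path_labelling G f" and x: "x \<in> verts G" "f x = 0" and y: "y \<in> verts G"
  shows "gdist G x y = ereal (real (f y))"
proof (rule antisym)
  show "gdist G x y \<le> ereal (real (f y))"
    using y
  proof (induction "f y" arbitrary: y)
    case 0
    then have "y = x"
      using x path_labelling_inj_on[OF f] by (metis inj_onD)
    then show ?case
      using x by (simp add: gdist_self zero_ereal_def)
  next
    case (Suc m)
    then have "m < card (verts G)"
      using path_labelling_less[OF f, of y] by simp
    then obtain w where w: "w \<in> verts G" "f w = m"
      by (rule path_labelling_vertex[OF f])
    then have "w \<rightarrow>\<^bsub>G\<^esub> y"
      using path_labelling_adj_iff[OF f, of w y] Suc by simp
    then have "gdist G x y \<le> gdist G x w + 1"
      by (rule gdist_adj_le)
    also have "gdist G x w + 1 \<le> ereal (real m) + 1"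
      using Suc.hyps(1)[of w] w by (intro add_right_mono) simp
    also have "\<dots> = ereal (real (f y))"
      using Suc.hyps(2)[symmetric] by (simp add: one_ereal_def)
    finally show ?case .
  qed
next
  have "f v \<le> f u + length p" if "awalk u p v" for u p v
    using that
  proof (induction p arbitrary: u)
    case Nil
    then show ?case by (simp add: awalk_Nil_iff)
  next
    case (Cons e p)
    then have e: "e \<in> arcs G" "tail G e = u" "awalk (head G e) p v"
      by (auto simp: awalk_Cons_iff)
    then have "u \<rightarrow>\<^bsub>G\<^esub> head G e" by (auto simp: arcs_ends_conv)
    then have "f (head G e) \<le> Suc (f u)"
      using path_labelling_adj_iff[OF f, of u "head G e"] adj_in_verts by auto
    then show ?case using Cons.IH[OF e(3)] by simp
  qed
  then show "ereal (real (f y)) \<le> gdist G x y"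
    unfolding gdist_eq_INF_length using x by (force intro: INF_greatest)
qed

text \<open>Applied to the set of distances from a vertex, this says that they form an initial
  segment of the naturals.\<close>

lemma downward_closed_eq_lessThan_card:
  fixes S :: "nat set"
  assumes "finite S" and closed: "\<And>m. Suc m \<in> S \<Longrightarrow> m \<in> S"
  shows "S = {..<card S}"
proof (cases "S = {}")
  case False
  have "i \<in> S" if "i \<le> Max S" for i
    using that
  proof (induction rule: inc_induct)
    case base
    then show ?case using assms(1) False by simp
  qed (rule closed)
  then have "S = {..Max S}"
    using assms(1) by auto
  then have "S = {..<Suc (Max S)}"
    by (simp add: lessThan_Suc_atMost)
  then show ?thesis by (metis card_lessThan)
qed simp

text \<open>The labelling is the distance from \<open>z\<close>. It has no gaps, since every vertex
  other than \<open>z\<close> has a neighbour one step closer. Labels of adjacent vertices differ by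
  at most one, and by injectivity they do differ.\<close>

lemma (in graph) path_labelling_of_inj_gdist:
  assumes conn: "connected G" and z: "z \<in> verts G" and inj: "inj_on (gdist G z) (verts G)"
  obtains f where "path_labelling G f" "f z = 0"
proof -
  have "\<forall>v \<in> verts G. \<exists>m. gdist G z v = ereal (real m)"
    using connected_reachable[OF conn z] gdist_eq_nat by metis
  then obtain f where f: "\<And>v. v \<in> verts G \<Longrightarrow> gdist G z v = ereal (real (f v))"
    by metis
  have inj_f: "inj_on f (verts G)"
    using inj f by (auto simp: inj_on_def)
  have fz: "f z = 0"
    using f[OF z] gdist_self[OF z] by (simp add: zero_ereal_def)
  have step: "f v \<le> Suc (f u)" if "u \<rightarrow>\<^bsub>G\<^esub> v" for u v
    using gdist_adj_le[OF that, of z] f adj_in_verts[OF that]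
    by (simp add: one_ereal_def)
  have pred: "\<exists>u. u \<rightarrow>\<^bsub>G\<^esub> v \<and> f v = Suc (f u)" if v: "v \<in> verts G" "f v \<noteq> 0" for v
  proof -
    have "v \<noteq> z" using v fz by auto
    then obtain u where u: "u \<rightarrow>\<^bsub>G\<^esub> v" "gdist G z v = gdist G z u + 1"
      using gdist_predecessor[OF connected_reachable[OF conn z v(1)]] by blast
    then have "ereal (real (f v)) = ereal (real (f u)) + 1"
      using f adj_in_verts[OF u(1)] by simp
    then have "f v = Suc (f u)" by (simp add: one_ereal_def)
    then show ?thesis using u by blast
  qed
  have "f ` verts G = {..<card (f ` verts G)}"
  proof (rule downward_closed_eq_lessThan_card)
    fix m assume "Suc m \<in> f ` verts G"
    then obtain v where v: "v \<in> verts G" "f v = Suc m" by auto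
    then obtain u where "u \<rightarrow>\<^bsub>G\<^esub> v" "f v = Suc (f u)" using pred[of v] by auto
    then show "m \<in> f ` verts G" using v adj_in_verts by auto
  qed simp
  then have img: "f ` verts G = {..<card (verts G)}"
    by (simp add: card_image[OF inj_f])
  \<comment> \<open>The neighbour of \<open>y\<close> one step closer to \<open>z\<close> has the
    label of \<open>x\<close>, hence is \<open>x\<close>.\<close>
  have succ: "x \<rightarrow>\<^bsub>G\<^esub> y" if xy: "x \<in> verts G" "y \<in> verts G" "f y = Suc (f x)" for x y
  proof -
    obtain u where u: "u \<rightarrow>\<^bsub>G\<^esub> y" "f y = Suc (f u)" using pred[of y] xy by auto
    then have "u = x" using xy inj_f adj_in_verts[OF u(1)] by (auto dest: inj_onD)
    then show ?thesis using u by simp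
  qed
  have "x \<rightarrow>\<^bsub>G\<^esub> y \<longleftrightarrow> f x = Suc (f y) \<or> f y = Suc (f x)"
    if xy: "x \<in> verts G" "y \<in> verts G" for x y
  proof
    assume adj: "x \<rightarrow>\<^bsub>G\<^esub> y"
    then have "x \<noteq> y" using adj_not_same by auto
    then have "f x \<noteq> f y" using inj_f xy by (auto dest: inj_onD)
    then show "f x = Suc (f y) \<or> f y = Suc (f x)"
      using step[OF adj] step[OF adj_sym[OF adj]] by linarith
  next
    assume "f x = Suc (f y) \<or> f y = Suc (f x)"
    then show "x \<rightarrow>\<^bsub>G\<^esub> y" using succ xy adj_sym by blast
  qed
  then have "path_labelling G f"
    using inj_f img by (simp add: path_labelling_def bij_betw_def)
  then show ?thesis using that fz by blast
qed

text \<open>An inner vertex of a path has two neighbours, and its distances to them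
  coincide.\<close>

lemma (in graph) inj_gdist_imp_path_end:
  assumes "connected G" and z: "z \<in> verts G" "inj_on (gdist G z) (verts G)"
    and f: "path_labelling G f"
  shows "f z = 0 \<or> f z = card (verts G) - 1"
proof (rule ccontr)
  assume neg: "\<not> ?thesis"
  have "f z < card (verts G)" by (rule path_labelling_less[OF f z(1)])
  with neg have "f z - 1 < card (verts G)" "Suc (f z) < card (verts G)" by auto
  then obtain a b where ab: "a \<in> verts G" "f a = f z - 1" "b \<in> verts G" "f b = Suc (f z)"
    using path_labelling_vertex[OF f] by metis
  then have adj: "z \<rightarrow>\<^bsub>G\<^esub> a" "z \<rightarrow>\<^bsub>G\<^esub> b"
    using neg path_labelling_adj_iff[OF f z(1)] by auto
  \<comment> \<open>A second labelling, starting at \<open>z\<close>: it would give both neighbours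
    of \<open>z\<close> the label 1.\<close>
  obtain d where d: "path_labelling G d" "d z = 0"
    using path_labelling_of_inj_gdist[OF assms(1) z] .
  have "d a = 1" "d b = 1"
    using adj ab d(2) path_labelling_adj_iff[OF d(1) z(1)] by auto
  then have "a = b"
    using ab path_labelling_inj_on[OF d(1)] by (metis inj_onD)
  then show False using ab by simp
qed

text \<open>One fixed labelling sends all these vertices to its two end labels. This count is the
  source of the bound 2 on \<open>k\<close>.\<close>

lemma (in graph) card_inj_gdist_le_2:
  assumes "connected G"
  shows "card {z \<in> verts G. inj_on (gdist G z) (verts G)} \<le> 2" (is "card ?S \<le> 2")
proof (cases "?S = {}")
  case False
  then obtain f where f: "path_labelling G f"
    using path_labelling_of_inj_gdist[OF assms] by blast
  have "card ?S = card (f ` ?S)"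
    using path_labelling_inj_on[OF f] by (intro card_image[symmetric]) (auto intro: inj_on_subset)
  also have "\<dots> \<le> card {0, card (verts G) - 1}"
  proof (rule card_mono)
    show "f ` ?S \<subseteq> {0, card (verts G) - 1}"
    proof (rule image_subsetI)
      fix z assume "z \<in> ?S"
      then have "z \<in> verts G" "inj_on (gdist G z) (verts G)" by auto
      then have "f z = 0 \<or> f z = card (verts G) - 1"
        by (rule inj_gdist_imp_path_end[OF assms _ _ f])
      then show "f z \<in> {0, card (verts G) - 1}" by blast
    qed
  qed simp
  also have "\<dots> \<le> 2" by (simp add: card_insert_if)
  finally show ?thesis .
next
  case True
  then show ?thesis by (simp only: card.empty)
qed


section \<open>Resolving sets and optimal resolving functions\<close>

lemma resolving_set_subset: "resolving_set G x y \<subseteq> verts G"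
  by (auto simp: resolving_set_def)

text \<open>Links the two views of \<open>z\<close>: resolving every pair, and having pairwise
  distinct distances to the vertices. Resolving sets compare distances to \<open>z\<close>, so
  symmetry of the distance is needed.\<close>

lemma (in sym_digraph) inj_on_gdist_iff_resolves:
  assumes "z \<in> verts G"
  shows "inj_on (gdist G z) (verts G) \<longleftrightarrow>
    (\<forall>x \<in> verts G. \<forall>y \<in> verts G. x \<noteq> y \<longrightarrow> z \<in> resolving_set G x y)"
proof -
  have "z \<in> resolving_set G x y \<longleftrightarrow> gdist G z x \<noteq> gdist G z y" for x y
    using assms gdist_sym[of x z] gdist_sym[of y z] by (simp add: resolving_set_def)
  then show ?thesis unfolding inj_on_def by blast
qed

text \<open>Ensures that the \<open>Min\<close> in \<open>kappa\<close> is a lower bound.\<close>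

lemma finite_card_resolving_sets:
  assumes "finite (verts G)"
  shows "finite {card (resolving_set G x y) | x y. x \<in> verts G \<and> y \<in> verts G \<and> x \<noteq> y}"
    (is "finite ?C")
proof (rule finite_subset)
  show "?C \<subseteq> (\<lambda>(x, y). card (resolving_set G x y)) ` (verts G \<times> verts G)"
    by auto
qed (simp add: assms)

lemma kappa_le_card_resolving_set:
  assumes "finite (verts G)" "x \<in> verts G" "y \<in> verts G" "x \<noteq> y"
  shows "kappa G \<le> card (resolving_set G x y)"
  unfolding kappa_def
  by (rule Min_le[OF finite_card_resolving_sets[OF assms(1)]]) (use assms in blast)

lemma R_kappa_subset: "R_kappa G \<subseteq> verts G"
  by (auto simp: R_kappa_def resolving_set_def)

lemma k_resolving_functionD:
  assumes "k_resolving_function G k g"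
  shows "\<And>v. v \<in> verts G \<Longrightarrow> 0 \<le> g v" "\<And>v. v \<in> verts G \<Longrightarrow> g v \<le> 1"
    "\<And>x y. x \<in> verts G \<Longrightarrow> y \<in> verts G \<Longrightarrow> x \<noteq> y \<Longrightarrow> k \<le> sum g (resolving_set G x y)"
  using assms by (auto simp: k_resolving_function_def)

text \<open>Every resolving set has at least \<open>kappa G\<close> vertices. The useful constants
  are 1 and \<open>k / kappa G\<close>.\<close>

lemma k_resolving_function_const:
  assumes "finite (verts G)" "0 \<le> c" "c \<le> 1" "k \<le> c * real (kappa G)"
  shows "k_resolving_function G k (\<lambda>_. c)"
  unfolding k_resolving_function_def
proof (intro conjI ballI impI)
  fix x y assume "x \<in> verts G" "y \<in> verts G" "x \<noteq> y"
  then have "c * real (kappa G) \<le> c * real (card (resolving_set G x y))"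
    using assms kappa_le_card_resolving_set[of G x y] by (intro mult_left_mono) auto
  then show "k \<le> (\<Sum>_ \<in> resolving_set G x y. c)"
    using assms by (simp add: mult.commute)
qed (use assms in auto)

text \<open>The total weight is continuous in the product topology and attains its infimum on a
  nonempty compact set of candidates.\<close>

lemma optimal_k_resolving_function_exists:
  assumes fin: "finite (verts G)" and k: "k \<le> real (kappa G)"
  obtains g where "k_resolving_function G k g"
    "\<And>g'. k_resolving_function G k g' \<Longrightarrow> sum g (verts G) \<le> sum g' (verts G)"
proof -
  \<comment> \<open>Resolving functions are unconstrained off the vertex set. Pinning them to 0
    there makes every factor compact, so the product is compact by Tychonoff, even over an infinite
    vertex type.\<close>
  define B where "B = Pi\<^sub>E UNIV (\<lambda>v. if v \<in> verts G then {0..1::real} else {0})"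
  define C where "C = {h. \<forall>x \<in> verts G. \<forall>y \<in> verts G. x \<noteq> y \<longrightarrow> k \<le> sum h (resolving_set G x y)}"
  \<comment> \<open>Moves an arbitrary resolving function into the compact set without changing its
    sums over sets of vertices.\<close>
  define cut where "cut g v = (if v \<in> verts G then g v else 0)" for g :: "'a \<Rightarrow> real" and v
  have cont: "continuous_on UNIV (\<lambda>h :: 'a \<Rightarrow> real. sum h A)" for A
    by (intro continuous_intros continuous_on_product_coordinates)
  have "compact B"
    unfolding B_def compactin_euclidean_iff[symmetric] euclidean_product_topology[symmetric] compactin_PiE
    by auto
  moreover have "closed C"
  proof -
    have "closed {h :: 'a \<Rightarrow> real. k \<le> sum h (resolving_set G x y)}" for x y
      by (intro closed_Collect_le cont continuous_on_const)
    moreover have "C = (\<Inter>x \<in> verts G. \<Inter>y \<in> verts G - {x}. {h. k \<le> sum h (resolving_set G x y)})"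
      by (auto simp: C_def)
    ultimately show ?thesis by auto
  qed
  ultimately have comp: "compact (B \<inter> C)" by (rule compact_Int_closed)
  have cut_sum: "sum (cut g) A = sum g A" if "A \<subseteq> verts G" for g A
    using that by (intro sum.cong) (auto simp: cut_def)
  have cut: "cut g \<in> B \<inter> C" if "k_resolving_function G k g" for g
    using k_resolving_functionD[OF that] cut_sum[OF resolving_set_subset]
    by (auto simp: B_def C_def PiE_iff) (auto simp: cut_def)
  have "k_resolving_function G k (\<lambda>_. 1)"
    using fin k by (intro k_resolving_function_const) auto
  then have "B \<inter> C \<noteq> {}" using cut by blast
  then obtain g where g: "g \<in> B \<inter> C" "\<And>h. h \<in> B \<inter> C \<Longrightarrow> sum g (verts G) \<le> sum h (verts G)"
    using continuous_attains_inf[OF comp _ continuous_on_subset[OF cont]] by blast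
  show ?thesis
  proof (rule that)
    show "k_resolving_function G k g"
      using g(1) by (auto simp: B_def C_def k_resolving_function_def PiE_iff split: if_splits)
    show "sum g (verts G) \<le> sum g' (verts G)" if "k_resolving_function G k g'" for g'
      using g(2)[OF cut[OF that]] cut_sum[of "verts G" g'] by simp
  qed
qed

lemma frac_metric_dim_eqI:
  assumes "k_resolving_function G k g" "sum g (verts G) = t"
    "\<And>g'. k_resolving_function G k g' \<Longrightarrow> t \<le> sum g' (verts G)"
  shows "frac_metric_dim G k = t"
  unfolding frac_metric_dim_def using assms by (intro Least_equality) auto

text \<open>An optimal function exists, so the \<open>LEAST\<close> in the definition is a genuine
  minimum.\<close>

lemma frac_metric_dim_attained:
  assumes "finite (verts G)" "k \<le> real (kappa G)"
  obtains g where "k_resolving_function G k g" "sum g (verts G) = frac_metric_dim G k"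
proof -
  obtain h where "k_resolving_function G k h"
    "\<And>g'. k_resolving_function G k g' \<Longrightarrow> sum h (verts G) \<le> sum g' (verts G)"
    using optimal_k_resolving_function_exists[OF assms] by blast
  then show ?thesis
    using frac_metric_dim_eqI[of G k h] that by simp
qed

lemma frac_metric_dim_le:
  assumes "finite (verts G)" "k_resolving_function G k g" "k \<le> real (kappa G)"
  shows "frac_metric_dim G k \<le> sum g (verts G)"
proof -
  obtain h where "k_resolving_function G k h"
    "\<And>g'. k_resolving_function G k g' \<Longrightarrow> sum h (verts G) \<le> sum g' (verts G)"
    using optimal_k_resolving_function_exists[OF assms(1,3)] by blast
  then show ?thesis
    using frac_metric_dim_eqI[of G k h] assms(2) by simp
qed

lemma sum_resolving_set_le:
  assumes "finite (verts G)" "k_resolving_function G k g"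
  shows "sum g (resolving_set G x y) \<le> sum g (verts G)"
  using assms k_resolving_functionD(1)[OF assms(2)] resolving_set_subset[of G x y]
  by (intro sum_mono2) auto


section \<open>The extremal cases\<close>

context graph
begin

text \<open>Both ends resolve every pair, so weight \<open>k / 2\<close> on each puts exactly
  \<open>k\<close> on every resolving set; \<open>k \<le> 2\<close> keeps these weights at most 1.
  Conversely, a single resolving set already forces total weight \<open>k\<close>.\<close>

lemma frac_metric_dim_path:
  assumes f: "path_labelling G f" and n: "2 \<le> card (verts G)" and k: "0 \<le> k" "k \<le> 2"
  shows "frac_metric_dim G k = k"
proof -
  have "0 < card (verts G)" "card (verts G) - 1 < card (verts G)" using n by auto
  then obtain a b where ab: "a \<in> verts G" "f a = 0" "b \<in> verts G" "f b = card (verts G) - 1"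
    using path_labelling_vertex[OF f] by metis
  have "a \<noteq> b" using ab n by auto
  \<comment> \<open>Labels are the distances from the vertex labelled 0, hence these distances are
    distinct. Stated for any labelling \<open>h\<close> so that it covers the other end through the
    reversed one.\<close>
  have end_resolves: "z \<in> resolving_set G x y"
    if "path_labelling G h" "z \<in> verts G" "h z = 0" "x \<in> verts G" "y \<in> verts G" "x \<noteq> y"
    for h z x y
  proof -
    have "inj_on (gdist G z) (verts G)"
      using path_labelling_inj_on[OF that(1)] gdist_path_labelling[OF that(1-3)]
      by (auto simp: inj_on_def)
    then show ?thesis using that inj_on_gdist_iff_resolves by blast
  qed
  have res: "{a, b} \<subseteq> resolving_set G x y" if "x \<in> verts G" "y \<in> verts G" "x \<noteq> y" for x y
    using end_resolves[OF f, of a x y] end_resolves[OF path_labelling_reverse[OF f], of b x y]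
      ab n that by auto
  define g where "g v = (if v \<in> {a, b} then k / 2 else 0)" for v
  have g_sum: "sum g A = k" if "{a, b} \<subseteq> A" "A \<subseteq> verts G" for A
  proof -
    have "finite A" using that(2) by (rule finite_subset) simp
    then have "sum g A = sum g {a, b}"
      using that by (intro sum.mono_neutral_right) (auto simp: g_def)
    then show ?thesis using \<open>a \<noteq> b\<close> by (simp add: g_def)
  qed
  show ?thesis
  proof (rule frac_metric_dim_eqI)
    show "k_resolving_function G k g"
      using k g_sum[OF res resolving_set_subset]
      by (auto simp: k_resolving_function_def g_def)
    show "sum g (verts G) = k" using ab g_sum[of "verts G"] by simp
    show "k \<le> sum g' (verts G)" if g': "k_resolving_function G k g'" for g'
      using k_resolving_functionD(3)[OF g' ab(1,3) \<open>a \<noteq> b\<close>]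
        sum_resolving_set_le[OF finite_verts g', of a b] by linarith
  qed
qed

text \<open>An optimal function of total weight k has all of its weight in every resolving set, so each
  vertex of positive weight resolves every pair of vertices.\<close>
lemma frac_metric_dim_eq_imp_path:
  assumes conn: "connected G" and k: "0 < k" "k \<le> real (kappa G)"
    and eq: "frac_metric_dim G k = k"
  shows "(\<exists>f. path_labelling G f) \<and> k \<le> 2"
proof -
  obtain g where g: "k_resolving_function G k g" "sum g (verts G) = k"
    using frac_metric_dim_attained[OF finite_verts k(2)] eq by metis
  note gD = k_resolving_functionD[OF g(1)]
  define S where "S = {z \<in> verts G. inj_on (gdist G z) (verts G)}"
  have zero: "g z = 0" if z: "z \<in> verts G" "z \<notin> S" for z
  proof -
    have "\<not> inj_on (gdist G z) (verts G)" using z by (simp add: S_def)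
    then obtain x y where xy: "x \<in> verts G" "y \<in> verts G" "x \<noteq> y" "z \<notin> resolving_set G x y"
      unfolding inj_on_gdist_iff_resolves[OF z(1)] by blast
    \<comment> \<open>The set missing \<open>z\<close> already weighs at least \<open>k\<close>, the
      total weight, so nothing is left for \<open>z\<close>.\<close>
    have "sum g (resolving_set G x y) + g z = sum g (insert z (resolving_set G x y))"
      using xy finite_subset[OF resolving_set_subset finite_verts, of x y] by simp
    also have "\<dots> \<le> sum g (verts G)"
      using z gD(1) resolving_set_subset[of G x y] by (intro sum_mono2) auto
    finally show ?thesis
      using gD(3)[OF xy(1-3)] gD(1)[OF z(1)] g(2) by linarith
  qed
  \<comment> \<open>All weight sits on \<open>S\<close> and weights are at most 1, so
    \<open>k\<close> is at most the size of \<open>S\<close>, which is at most 2. As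
    \<open>k\<close> is positive, \<open>S\<close> is nonempty and yields an end of the
    path.\<close>
  have "k = sum g S"
    unfolding g(2)[symmetric] using zero by (intro sum.mono_neutral_right) (auto simp: S_def)
  also have "\<dots> \<le> (\<Sum>_ \<in> S. 1)"
    using gD(2) by (intro sum_mono) (auto simp: S_def)
  finally have kS: "k \<le> real (card S)" by simp
  moreover have "card S \<le> 2"
    unfolding S_def by (rule card_inj_gdist_le_2[OF conn])
  ultimately have "k \<le> 2" by linarith
  have "S \<noteq> {}" using kS k by auto
  then obtain z where "z \<in> verts G" "inj_on (gdist G z) (verts G)" by (auto simp: S_def)
  then obtain f where "path_labelling G f"
    by (rule path_labelling_of_inj_gdist[OF conn])
  with \<open>k \<le> 2\<close> show ?thesis by blast
qed

end

section \<open>Dimension equal to the order: covering by minimum resolving sets\<close>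

lemma frac_metric_dim_R_kappa:
  assumes fin: "finite (verts G)" and cover: "verts G = R_kappa G"
  shows "frac_metric_dim G (real (kappa G)) = real (card (verts G))"
proof (rule frac_metric_dim_eqI)
  show "k_resolving_function G (real (kappa G)) (\<lambda>_. 1)"
    using fin by (intro k_resolving_function_const) auto
  show "(\<Sum>_ \<in> verts G. 1) = real (card (verts G))" by simp
  fix g assume g: "k_resolving_function G (real (kappa G)) g"
  note gD = k_resolving_functionD[OF g]
  \<comment> \<open>A minimum resolving set through \<open>v\<close> needs weight
    \<open>kappa G\<close>, and its other vertices contribute at most
    \<open>kappa G - 1\<close>.\<close>
  have "1 \<le> g v" if v: "v \<in> verts G" for v
  proof -
    have "v \<in> R_kappa G" using v by (subst (asm) cover)
    then obtain x y where xy: "x \<in> verts G" "y \<in> verts G" "x \<noteq> y"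
      "card (resolving_set G x y) = kappa G" "v \<in> resolving_set G x y"
      by (auto simp: R_kappa_def)
    have R: "finite (resolving_set G x y)"
      using resolving_set_subset fin by (rule finite_subset)
    have "real (kappa G) \<le> g v + sum g (resolving_set G x y - {v})"
      using gD(3)[OF xy(1-3)] sum.remove[OF R xy(5), of g] by linarith
    also have "sum g (resolving_set G x y - {v}) \<le> (\<Sum>_ \<in> resolving_set G x y - {v}. 1)"
      using gD(2) resolving_set_subset[of G x y] by (intro sum_mono) blast
    also have "\<dots> = real (kappa G) - 1"
    proof -
      have "real (card (resolving_set G x y - {v})) = real (kappa G) - 1"
        using card_Suc_Diff1[OF R xy(5)] xy(4) by linarith
      then show ?thesis by (simp only: sum_constant mult_1_right)
    qed
    finally show ?thesis by linarith
  qed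
  then have "(\<Sum>_ \<in> verts G. 1) \<le> sum g (verts G)" by (intro sum_mono)
  then show "real (card (verts G)) \<le> sum g (verts G)" by simp
qed

lemma frac_metric_dim_eq_card_imp:
  assumes fin: "finite (verts G)" and ne: "verts G \<noteq> {}" and k: "0 \<le> k" "k \<le> real (kappa G)"
    and eq: "frac_metric_dim G k = real (card (verts G))"
  shows "k = real (kappa G) \<and> verts G = R_kappa G"
proof -
  have min: "real (card (verts G)) \<le> sum g (verts G)" if "k_resolving_function G k g" for g
    using frac_metric_dim_le[OF fin that k(2)] eq by simp
  have k_eq: "k = real (kappa G)"
  proof (rule ccontr)
    assume "k \<noteq> real (kappa G)"
    with k have less: "k < real (kappa G)" and pos: "0 < real (kappa G)" by auto
    then have "k_resolving_function G k (\<lambda>_. k / real (kappa G))"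
      using fin k by (intro k_resolving_function_const) auto
    from min[OF this] have "real (card (verts G)) \<le> real (card (verts G)) * (k / real (kappa G))"
      by simp
    \<comment> \<open>Strictness also uses that there is at least one vertex.\<close>
    moreover have "real (card (verts G)) * (k / real (kappa G)) < real (card (verts G)) * 1"
      using less pos fin ne by (intro mult_strict_left_mono) (auto simp: card_gt_0_iff)
    ultimately show False by simp
  qed
  have "v \<in> R_kappa G" if v: "v \<in> verts G" for v
  proof (rule ccontr)
    assume nv: "v \<notin> R_kappa G"
    \<comment> \<open>Dropping \<open>v\<close> costs weight only in resolving sets containing
      \<open>v\<close>. As \<open>v\<close> lies in no minimum one, these have at least
      \<open>kappa G + 1\<close> vertices and can afford the loss.\<close>
    define g where "g u = (if u = v then 0 else 1 :: real)" for u
    have g_sum: "sum g A = real (card (A - {v}))" if "finite A" for A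
    proof -
      have "sum g A = sum g (A - {v})"
        using that by (intro sum.mono_neutral_right) (auto simp: g_def)
      then show ?thesis by (simp add: g_def)
    qed
    have "k_resolving_function G k g"
      unfolding k_resolving_function_def
    proof (intro conjI ballI impI)
      fix x y assume xy: "x \<in> verts G" "y \<in> verts G" "x \<noteq> y"
      let ?R = "resolving_set G x y"
      have R: "finite ?R" using resolving_set_subset fin by (rule finite_subset)
      have ge: "kappa G \<le> card ?R" using fin xy by (rule kappa_le_card_resolving_set)
      have "kappa G \<le> card (?R - {v})"
      proof (cases "v \<in> ?R")
        case True
        then have "card ?R \<noteq> kappa G" using nv xy unfolding R_kappa_def by blast
        then show ?thesis using ge card_Suc_Diff1[OF R True] by linarith
      next
        case False
        then show ?thesis using ge by simp
      qed
      then show "k \<le> sum g ?R" unfolding g_sum[OF R] k_eq of_nat_le_iff .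
    qed (simp add: g_def)
    from min[OF this] have "card (verts G) \<le> card (verts G - {v})"
      unfolding g_sum[OF fin] of_nat_le_iff .
    then show False using card_Diff1_less[OF fin v] by linarith
  qed
  then have "verts G = R_kappa G" using R_kappa_subset[of G] by (intro equalityI subsetI) auto
  with k_eq show ?thesis ..
qed

theorem proposition3p5:
  fixes G :: "('a, 'b) pre_digraph" and n :: nat and k :: real
  assumes "Digraph.graph G"
    and "Digraph_Component.connected G"
    and "n = card (verts G)" and "n \<ge> 2"
    and "k \<in> {1..real (kappa G)}"
  shows "(frac_metric_dim G k = k \<longleftrightarrow>
            digraph_iso G (with_proj (path_graph n)) \<and> k \<in> {1..2}) \<and>
         (frac_metric_dim G k = real n \<longleftrightarrow>
            k = real (kappa G) \<and> verts G = R_kappa G)"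
proof -
  interpret graph G by (rule assms(1))
  have k: "1 \<le> k" "k \<le> real (kappa G)" using assms(5) by auto
  have ne: "verts G \<noteq> {}" using assms(3,4) by auto
  \<comment> \<open>Part (a) is proved for labellings; \<open>digraph_iso_path_iff\<close> turns it
    into the isomorphism at the end.\<close>
  have "frac_metric_dim G k = k \<longleftrightarrow> (\<exists>f. path_labelling G f) \<and> k \<in> {1..2}"
  proof
    assume "frac_metric_dim G k = k"
    then show "(\<exists>f. path_labelling G f) \<and> k \<in> {1..2}"
      using frac_metric_dim_eq_imp_path[OF assms(2) _ k(2)] k(1) by simp
  next
    assume "(\<exists>f. path_labelling G f) \<and> k \<in> {1..2}"
    then show "frac_metric_dim G k = k"
      using frac_metric_dim_path[of _ k] assms(3,4) by auto
  qed
  moreover have "frac_metric_dim G k = real n \<longleftrightarrow> k = real (kappa G) \<and> verts G = R_kappa G"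
  proof
    assume "frac_metric_dim G k = real n"
    then show "k = real (kappa G) \<and> verts G = R_kappa G"
      using k(1) assms(3) by (intro frac_metric_dim_eq_card_imp[OF finite_verts ne _ k(2)]) simp_all
  next
    assume R: "k = real (kappa G) \<and> verts G = R_kappa G"
    then have "frac_metric_dim G (real (kappa G)) = real (card (verts G))"
      by (intro frac_metric_dim_R_kappa[OF finite_verts]) (rule conjunct2)
    then show "frac_metric_dim G k = real n"
      unfolding assms(3) conjunct1[OF R] .
  qed
  ultimately show ?thesis
    using digraph_iso_path_iff assms(3) by simp
qed

end
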